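(* For any set $X\in\mathbf P$ and any set $A\subseteq\{0,1\}^+$, we have $\mathcal F^{\preccurlyeq}_{(A,\mathbf{FPT})}=\mathcal F^{\preccurlyeq}_{(A\triangle X,\mathbf{FPT})}$; i.e., for every parameterization $\eta$, $(A,\eta)\in\mathbf{FPT}$ if and only if $(A\triangle X,\eta)\in\mathbf{FPT}$.
   Context: $A\triangle X=(A\setminus X)\cup(X\setminus A)$. A Turing machine $\Phi$ is a partial decision procedure for $A$ if $\Phi(x)=1\Rightarrow x\in A$ and $\Phi(x)=0\Rightarrow x\notin A$; $\mathrm{dom}(\Phi)=\{x:\Phi(x)\in\{0,1\}\}$. An $O(n^c)$-approximation for $A$ is a partial decision procedure for $A$ halting on all inputs in time $O(n^c)$. A parameter space is a nonempty set $\Omega$ with a reflexive, transitive, directed relation and an injective encoding into $\{0,1\}^+$. A parameterization over $\Omega$ is $\eta\subseteq\{0,1\}^+\times\Omega$ such that for every $x$, $\{k:(x,k)\in\eta\}$ is nonempty and upward closed; $\eta_k=\{x:(x,k)\in\eta\}$. $(A,\eta)\in\mathbf{FPT}$ if there are a constant $c$, a Turing machine $\Psi$ with two inputs and a computable $f$ such that for every parameter value $k$, $\Psi(k,\cdot)$ is an $O(n^c)$-approximation for $A$ with domain $\eta_k$ and running time at most $f(k)\cdot n^c$. $\mathcal F^{\preccurlyeq}_{(A,\mathbf{FPT})}$ denotes the set of parameterizations $\eta$ with $(A,\eta)\in\mathbf{FPT}$. *)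

theory Defs
  imports Complex_Main "HOL-Library.Landau_Symbols"
begin

section \<open>Binary words\<close>

definition bin_words :: "bool list set" where
  "bin_words = {w. w \<noteq> []}"

section \<open>Turing machines\<close>

text \<open>
  Deterministic Turing machines with finitely many two-way infinite tapes, finitely many
  states and a finite tape alphabet. A machine stops as soon as it enters a final state.
\<close>

datatype sym = Blank | Bit bool | Work nat

datatype dir = Left | Stay | Right

fun offset :: "dir \<Rightarrow> int" where
  "offset Left = -1"
| "offset Stay = 0"
| "offset Right = 1"

record tm =
  tapes :: nat
  states :: "nat set"
  alphabet :: "sym set"
  start :: nat
  final :: "nat set"
  delta :: "nat \<Rightarrow> sym list \<Rightarrow> nat \<times> (sym \<times> dir) list"

text \<open>The parameter \<open>r\<close> is the number of inputs; each input has a tape of its own.\<close>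

definition turing_machine :: "nat \<Rightarrow> tm \<Rightarrow> bool" where
  "turing_machine r M \<longleftrightarrow>
     0 < tapes M \<and> r \<le> tapes M \<and>
     finite (states M) \<and> start M \<in> states M \<and> final M \<subseteq> states M \<and>
     finite (alphabet M) \<and> Blank \<in> alphabet M \<and> range Bit \<subseteq> alphabet M \<and>
     (\<forall>q \<in> states M - final M. \<forall>ss. length ss = tapes M \<and> set ss \<subseteq> alphabet M \<longrightarrow>
        (case delta M q ss of (q', acts) \<Rightarrow>
           q' \<in> states M \<and> length acts = tapes M \<and> fst ` set acts \<subseteq> alphabet M))"

text \<open>A tape is its contents together with the head position.\<close>

type_synonym tape = "(int \<Rightarrow> sym) \<times> int"

type_synonym config = "nat \<times> tape list"

fun read :: "tape \<Rightarrow> sym" where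
  "read (t, h) = t h"

fun act :: "sym \<times> dir \<Rightarrow> tape \<Rightarrow> tape" where
  "act (s, d) (t, h) = (t(h := s), h + offset d)"

fun step :: "tm \<Rightarrow> config \<Rightarrow> config" where
  "step M (q, ts) =
     (if q \<in> final M then (q, ts)
      else case delta M q (map read ts) of (q', acts) \<Rightarrow> (q', map2 act acts ts))"

definition word_tape :: "bool list \<Rightarrow> tape" where
  "word_tape w =
     ((\<lambda>i. if 0 \<le> i \<and> i < int (length w) then Bit (w ! nat i) else Blank), 0)"

definition initial :: "tm \<Rightarrow> bool list list \<Rightarrow> config" where
  "initial M ws =
     (start M, map word_tape ws @ replicate (tapes M - length ws) (word_tape []))"

definition run :: "tm \<Rightarrow> bool list list \<Rightarrow> nat \<Rightarrow> config" where
  "run M ws t = (step M ^^ t) (initial M ws)"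

definition halts_within :: "tm \<Rightarrow> bool list list \<Rightarrow> nat \<Rightarrow> bool" where
  "halts_within M ws t \<longleftrightarrow> fst (run M ws t) \<in> final M"

text \<open>The longest binary word that starts at the head position and extends to the right.\<close>

fun shows_word :: "tape \<Rightarrow> bool list \<Rightarrow> bool" where
  "shows_word (t, h) w \<longleftrightarrow>
     (\<forall>i < length w. t (h + int i) = Bit (w ! i)) \<and> t (h + int (length w)) \<notin> range Bit"

text \<open>
  The last tape is the output tape. \<open>outputs M ws w\<close> says that \<open>M\<close> halts on the inputs
  \<open>ws\<close> with output \<open>w\<close>; there is at most one such \<open>w\<close>.
\<close>

definition outputs :: "tm \<Rightarrow> bool list list \<Rightarrow> bool list \<Rightarrow> bool" where
  "outputs M ws w \<longleftrightarrow>
     (\<exists>t. halts_within M ws t \<and> shows_word (last (snd (run M ws t))) w)"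

section \<open>Polynomial time and approximations\<close>

text \<open>
  In the following definitions \<open>us\<close> is a list of fixed leading inputs, so that the procedure
  under consideration is \<open>x \<mapsto> M(us, x)\<close>: for a machine with one input \<open>us\<close> is empty, and
  for the section of a machine with two inputs at \<open>u\<close> it is the singleton \<open>[u]\<close>.
  The answers 1 and 0 are the one-letter words \<open>[True]\<close> and \<open>[False]\<close>.
\<close>

definition partial_decision_procedure ::
    "tm \<Rightarrow> bool list list \<Rightarrow> bool list set \<Rightarrow> bool" where
  "partial_decision_procedure M us A \<longleftrightarrow>
     (\<forall>x \<in> bin_words. (outputs M (us @ [x]) [True] \<longrightarrow> x \<in> A) \<and>
                      (outputs M (us @ [x]) [False] \<longrightarrow> x \<notin> A))"

definition proc_dom :: "tm \<Rightarrow> bool list list \<Rightarrow> bool list set" where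
  "proc_dom M us =
     {x \<in> bin_words. outputs M (us @ [x]) [True] \<or> outputs M (us @ [x]) [False]}"

definition runs_in_time :: "tm \<Rightarrow> bool list list \<Rightarrow> (nat \<Rightarrow> nat) \<Rightarrow> bool" where
  "runs_in_time M us T \<longleftrightarrow>
     (\<forall>x \<in> bin_words. halts_within M (us @ [x]) (T (length x)))"

definition poly_bounded :: "nat \<Rightarrow> tm \<Rightarrow> bool list list \<Rightarrow> bool" where
  "poly_bounded c M us \<longleftrightarrow>
     (\<exists>T. runs_in_time M us T \<and> (\<lambda>n. real (T n)) \<in> O(\<lambda>n. real n ^ c))"

definition approximation ::
    "nat \<Rightarrow> tm \<Rightarrow> bool list list \<Rightarrow> bool list set \<Rightarrow> bool" where
  "approximation c M us A \<longleftrightarrow>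
     partial_decision_procedure M us A \<and> poly_bounded c M us"

definition class_P :: "bool list set set" where
  "class_P =
     {X. X \<subseteq> bin_words \<and>
         (\<exists>M c. turing_machine 1 M \<and> poly_bounded c M [] \<and>
                (\<forall>x \<in> bin_words. outputs M [x] [x \<in> X]))}"

section \<open>Parameterizations\<close>

record 'k pspace =
  params :: "'k set"
  leq :: "'k \<Rightarrow> 'k \<Rightarrow> bool"
  code :: "'k \<Rightarrow> bool list"

definition parameter_space :: "'k pspace \<Rightarrow> bool" where
  "parameter_space S \<longleftrightarrow>
     params S \<noteq> {} \<and>
     reflp_on (params S) (leq S) \<and>
     transp_on (params S) (leq S) \<and>
     (\<forall>k \<in> params S. \<forall>l \<in> params S. \<exists>m \<in> params S. leq S k m \<and> leq S l m) \<and>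
     inj_on (code S) (params S) \<and>
     code S ` params S \<subseteq> bin_words"

definition parameterization :: "'k pspace \<Rightarrow> (bool list \<times> 'k) set \<Rightarrow> bool" where
  "parameterization S \<eta> \<longleftrightarrow>
     \<eta> \<subseteq> bin_words \<times> params S \<and>
     (\<forall>x \<in> bin_words.
        {k. (x, k) \<in> \<eta>} \<noteq> {} \<and>
        (\<forall>k l. (x, k) \<in> \<eta> \<and> l \<in> params S \<and> leq S k l \<longrightarrow> (x, l) \<in> \<eta>))"

definition slice :: "(bool list \<times> 'k) set \<Rightarrow> 'k \<Rightarrow> bool list set" where
  "slice \<eta> k = {x. (x, k) \<in> \<eta>}"

text \<open>Function values are written in unary; parameters are given by their encodings.\<close>

definition computable_on :: "'k pspace \<Rightarrow> ('k \<Rightarrow> nat) \<Rightarrow> bool" where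
  "computable_on S f \<longleftrightarrow>
     (\<exists>M. turing_machine 1 M \<and>
          (\<forall>k \<in> params S. outputs M [code S k] (replicate (f k) True)))"

definition in_FPT :: "'k pspace \<Rightarrow> bool list set \<Rightarrow> (bool list \<times> 'k) set \<Rightarrow> bool" where
  "in_FPT S A \<eta> \<longleftrightarrow>
     (\<exists>c \<Psi> f. turing_machine 2 \<Psi> \<and> computable_on S f \<and>
        (\<forall>k \<in> params S.
           approximation c \<Psi> [code S k] A \<and>
           proc_dom \<Psi> [code S k] = slice \<eta> k \<and>
           runs_in_time \<Psi> [code S k] (\<lambda>n. f k * n ^ c)))"

definition FPT_parameterizations ::
    "'k pspace \<Rightarrow> bool list set \<Rightarrow> (bool list \<times> 'k) set set" where
  "FPT_parameterizations S A = {\<eta>. parameterization S \<eta> \<and> in_FPT S A \<eta>}"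

end

theory Submission
  imports Defs "HOL-Library.Countable"
begin

text \<open>
  Symmetric difference with \<open>X\<close> is an involution, so one implication suffices. Given a machine
  for \<open>(A, \<eta>)\<close> and a polynomial-time machine for \<open>X\<close>, a new machine copies \<open>x\<close> to
  the input tape of the second one, rewinds, runs both machines in parallel until both have
  stopped, and then writes the exclusive or of the two answers to a fresh output tape, or nothing
  if the first answer is not a single bit. The overhead is linear in \<open>n\<close> plus the polynomial
  time bound for \<open>X\<close>. Since words are nonempty it is absorbed by a larger exponent and a
  constant added to \<open>f\<close>, and adding a constant preserves computability.
\<close>

section \<open>Runs of Turing machines\<close>

lemma turing_machineI:
  assumes "0 < tapes M" "r \<le> tapes M" "finite (states M)" "start M \<in> states M"
    "final M \<subseteq> states M" "finite (alphabet M)" "Blank \<in> alphabet M" "range Bit \<subseteq> alphabet M"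
    and "\<And>q ss q' acts. \<lbrakk>q \<in> states M; q \<notin> final M; length ss = tapes M; set ss \<subseteq> alphabet M;
      delta M q ss = (q', acts)\<rbrakk> \<Longrightarrow>
      q' \<in> states M \<and> length acts = tapes M \<and> fst ` set acts \<subseteq> alphabet M"
  shows "turing_machine r M"
proof -
  have "case delta M q ss of (q', acts) \<Rightarrow>
      q' \<in> states M \<and> length acts = tapes M \<and> fst ` set acts \<subseteq> alphabet M"
    if "q \<in> states M - final M" "length ss = tapes M \<and> set ss \<subseteq> alphabet M" for q ss
    using assms(9)[of q ss] that by (simp split: prod.splits)
  then show ?thesis using assms(1-8) by (simp add: turing_machine_def)
qed

lemma turing_machine_delta:
  assumes "turing_machine r M" "q \<in> states M" "q \<notin> final M" "length ss = tapes M"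
    "set ss \<subseteq> alphabet M" "delta M q ss = (q', acts)"
  shows "q' \<in> states M \<and> length acts = tapes M \<and> fst ` set acts \<subseteq> alphabet M"
proof -
  have "case delta M q ss of (q', acts) \<Rightarrow>
      q' \<in> states M \<and> length acts = tapes M \<and> fst ` set acts \<subseteq> alphabet M"
    using assms(1-5) by (simp add: turing_machine_def)
  then show ?thesis using assms(6) by simp
qed

text \<open>The run invariant: \<open>turing_machine\<close> constrains \<open>delta\<close> only on
  states and scanned symbols of the machine, so every later argument about a transition must know
  that the run has not left them.\<close>

definition config_ok :: "tm \<Rightarrow> config \<Rightarrow> bool" where
  "config_ok M c \<longleftrightarrow> fst c \<in> states M \<and> length (snd c) = tapes M \<and>
     (\<forall>tp \<in> set (snd c). range (fst tp) \<subseteq> alphabet M)"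

lemma read_eq: "read tp = fst tp (snd tp)"
  by (cases tp) simp

lemma config_ok_reads:
  assumes "config_ok M (q, ts)"
  shows "set (map read ts) \<subseteq> alphabet M"
  using assms unfolding config_ok_def by (auto simp: read_eq)

text \<open>With at most \<open>r\<close> inputs, and \<open>r\<close> at most
  \<open>tapes M\<close>, padding by blank tapes gives exactly \<open>tapes M\<close> tapes.\<close>

lemma config_ok_initial:
  assumes "turing_machine r M" "length ws \<le> r"
  shows "config_ok M (initial M ws)"
proof -
  have "fst (word_tape w) i \<in> alphabet M" for w i
    using assms(1) by (auto simp: word_tape_def turing_machine_def)
  moreover have "set (snd (initial M ws)) \<subseteq> range word_tape"
    by (auto simp: initial_def)
  ultimately have "\<forall>tp \<in> set (snd (initial M ws)). range (fst tp) \<subseteq> alphabet M"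
    by blast
  then show ?thesis
    using assms unfolding config_ok_def by (auto simp: initial_def turing_machine_def)
qed

lemma config_ok_step:
  assumes M: "turing_machine r M" and ok: "config_ok M c"
  shows "config_ok M (step M c)"
proof -
  obtain q ts where c: "c = (q, ts)" by (cases c)
  show ?thesis
  proof (cases "q \<in> final M")
    case True
    then show ?thesis using ok c by simp
  next
    case False
    obtain q' acts where d: "delta M q (map read ts) = (q', acts)" by fastforce
    have *: "q' \<in> states M" "length acts = tapes M" "fst ` set acts \<subseteq> alphabet M"
      using turing_machine_delta[OF M _ False _ config_ok_reads[OF ok[unfolded c]] d] ok c
      by (simp_all add: config_ok_def)
    have "range (fst (act a tp)) \<subseteq> alphabet M" if "(a, tp) \<in> set (zip acts ts)" for a tp
    proof -
      have "fst a \<in> alphabet M" "range (fst tp) \<subseteq> alphabet M"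
        using set_zip_leftD[OF that] set_zip_rightD[OF that] * ok c
        by (simp_all add: config_ok_def image_subset_iff)
      then show ?thesis by (cases a; cases tp) auto
    qed
    moreover have "\<exists>a tp'. (a, tp') \<in> set (zip acts ts) \<and> tp = act a tp'"
      if "tp \<in> set (map2 act acts ts)" for tp
      using that by (auto simp del: act.simps split_paired_Ex)
    ultimately have "\<forall>tp \<in> set (map2 act acts ts). range (fst tp) \<subseteq> alphabet M"
      by blast
    then show ?thesis
      using * False d ok c by (simp add: config_ok_def)
  qed
qed

section \<open>Runs, halting times and outputs\<close>

lemma run_0: "run M ws 0 = initial M ws"
  by (simp add: run_def)

lemma run_Suc: "run M ws (Suc t) = step M (run M ws t)"
  by (simp add: run_def)

lemma config_ok_run:
  assumes "turing_machine r M" "length ws \<le> r"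
  shows "config_ok M (run M ws t)"
  by (induction t)
    (simp_all only: run_0 run_Suc config_ok_initial[OF assms] config_ok_step[OF assms(1)])

lemma run_stable:
  assumes "halts_within M ws t" "t \<le> t'"
  shows "run M ws t' = run M ws t"
  using assms(2)
proof (induction t' rule: dec_induct)
  case (step n)
  then show ?case
    using assms(1) by (cases "run M ws t") (simp add: run_Suc halts_within_def)
qed simp

lemma halts_within_mono:
  assumes "halts_within M ws t" "t \<le> t'"
  shows "halts_within M ws t'"
  using assms run_stable[OF assms] by (simp add: halts_within_def)

text \<open>A halted configuration no longer changes, so the tapes at any two halting times agree
  and the output may be read off at whichever one is at hand.\<close>

lemma outputs_iff:
  assumes "halts_within M ws t"
  shows "outputs M ws w \<longleftrightarrow> shows_word (last (snd (run M ws t))) w"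
proof
  assume "outputs M ws w"
  then obtain t' where t': "halts_within M ws t'" "shows_word (last (snd (run M ws t'))) w"
    by (auto simp: outputs_def)
  have "run M ws t' = run M ws t"
    using run_stable[OF assms] run_stable[OF t'(1)] by (metis nat_le_linear)
  then show "shows_word (last (snd (run M ws t))) w" using t' by simp
qed (use assms in \<open>auto simp: outputs_def\<close>)

lemma shows_word_singleton:
  "shows_word (t, h) [b] \<longleftrightarrow> t h = Bit b \<and> t (h + 1) \<notin> range Bit"
  by simp

text \<open>The idle action on one tape. Transitions touching only one or two tapes are written as
  updates of \<open>map stay ss\<close>, so that their effect is an update of the tape list.\<close>

definition stay :: "sym \<Rightarrow> sym \<times> dir" where
  "stay s = (s, Stay)"

lemma map2_act_stay: "map2 act (map stay (map read ts)) ts = ts"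
  by (induction ts) (auto simp: stay_def)

lemma map2_update:
  assumes "length xs = length ys"
  shows "map2 f (xs[i := a]) ys = (map2 f xs ys)[i := f a (ys ! i)]"
proof (rule nth_equalityI)
  fix k
  assume "k < length (map2 f (xs[i := a]) ys)"
  then show "map2 f (xs[i := a]) ys ! k = (map2 f xs ys)[i := f a (ys ! i)] ! k"
    using assms by (cases "k = i") auto
qed simp

lemma map2_act_stay_update:
  "map2 act ((map stay (map read ts))[i := a]) ts = ts[i := act a (ts ! i)]"
  using map2_act_stay[of ts] by (simp add: map2_update del: map_map)

lemma map2_act_stay_update2:
  assumes "i \<noteq> j"
  shows "map2 act ((map stay (map read ts))[i := a, j := b]) ts
    = ts[i := act a (ts ! i), j := act b (ts ! j)]"
  using map2_act_stay[of ts] by (simp add: map2_update del: map_map)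

section \<open>Adding a constant to a computable function\<close>

text \<open>Instead of stopping, the machine prepends a \<open>True\<close> to its output.\<close>

definition succ_machine :: "tm \<Rightarrow> tm" where
  "succ_machine M =
     (let a = Suc (Max (states M)) in
      M\<lparr>states := insert a (insert (Suc a) (states M)),
        final := {Suc a},
        delta := (\<lambda>q ss.
          if q = a then (Suc a, (map stay ss)[tapes M - 1 := (Bit True, Stay)])
          else if q \<in> final M then
            (a, (map stay ss)[tapes M - 1 := (ss ! (tapes M - 1), Left)])
          else delta M q ss)\<rparr>)"

lemma succ_machine_simps [simp]:
  "tapes (succ_machine M) = tapes M"
  "alphabet (succ_machine M) = alphabet M"
  "start (succ_machine M) = start M"
  "states (succ_machine M) =
     insert (Suc (Max (states M))) (insert (Suc (Suc (Max (states M)))) (states M))"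
  "final (succ_machine M) = {Suc (Suc (Max (states M)))}"
  by (simp_all add: succ_machine_def Let_def)

lemma set_map_stay_update:
  assumes "set ss \<subseteq> B" "s \<in> B"
  shows "fst ` set ((map stay ss)[i := (s, d)]) \<subseteq> B"
proof -
  have "fst ` set ((map stay ss)[i := (s, d)]) \<subseteq> insert s (fst ` stay ` set ss)"
    using image_mono[OF set_update_subset_insert[of "map stay ss" i "(s, d)"], of fst] by simp
  also have "\<dots> = insert s (set ss)" by (simp add: stay_def image_image)
  finally show ?thesis using assms by blast
qed

lemma turing_machine_succ_machine:
  assumes M: "turing_machine r M"
  shows "turing_machine r (succ_machine M)"
proof (rule turing_machineI)
  fix q ss q' acts
  assume q: "q \<in> states (succ_machine M)" "q \<notin> final (succ_machine M)"
    and ss: "length ss = tapes (succ_machine M)" "set ss \<subseteq> alphabet (succ_machine M)"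
    and d: "delta (succ_machine M) q ss = (q', acts)"
  let ?a = "Suc (Max (states M))" and ?l = "tapes M - 1"
  have "?l < length ss" using M ss by (auto simp: turing_machine_def)
  then have last: "ss ! ?l \<in> alphabet M" using ss by (metis nth_mem subsetD succ_machine_simps(2))
  have tr: "Bit True \<in> alphabet M" using M by (auto simp: turing_machine_def)
  note ss' = ss[simplified]
  consider "q = ?a" | "q \<noteq> ?a" "q \<in> final M" | "q \<noteq> ?a" "q \<in> states M" "q \<notin> final M"
    using q by auto
  then show "q' \<in> states (succ_machine M) \<and> length acts = tapes (succ_machine M) \<and>
      fst ` set acts \<subseteq> alphabet (succ_machine M)"
  proof cases
    case 1
    then have "q' = Suc ?a" "acts = (map stay ss)[?l := (Bit True, Stay)]"
      using d by (auto simp: succ_machine_def Let_def)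
    then show ?thesis using ss' set_map_stay_update[OF ss'(2) tr] by simp
  next
    case 2
    then have "q' = ?a" "acts = (map stay ss)[?l := (ss ! ?l, Left)]"
      using d by (auto simp: succ_machine_def Let_def)
    then show ?thesis using ss' set_map_stay_update[OF ss'(2) last] by simp
  next
    case 3
    then have "delta M q ss = (q', acts)" using d by (simp add: succ_machine_def Let_def)
    then show ?thesis using turing_machine_delta[OF M 3(2,3) ss'] by simp
  qed
qed (use M in \<open>auto simp: turing_machine_def\<close>)

text \<open>The new letter goes to the cell left of the head, which the old word does not use;
  two-way infinite tapes always provide that cell.\<close>

lemma shows_word_Cons:
  assumes "shows_word (t, h) w"
  shows "shows_word (t(h - 1 := Bit b), h - 1) (b # w)"
proof -
  have "(t(h - 1 := Bit b)) (h - 1 + int i) = Bit ((b # w) ! i)" if "i < length (b # w)" for i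
    using assms that by (cases i) auto
  then show ?thesis using assms by auto
qed

text \<open>Up to the first halting time both machines make the same moves. Two extra steps then
  move the output head left and write \<open>True\<close> there.\<close>

lemma outputs_succ_machine:
  assumes M: "turing_machine r M" and ws: "length ws \<le> r" and out: "outputs M ws w"
  shows "outputs (succ_machine M) ws (True # w)"
proof -
  let ?N = "succ_machine M" and ?l = "tapes M - 1"
  define a where "a = Suc (Max (states M))"
  have fin: "finite (states M)" using M by (simp add: turing_machine_def)
  \<comment> \<open>The two added states exceed the maximum of the old ones, so no state of
    \<open>M\<close> triggers their transitions.\<close>
  have fresh: "q \<noteq> a \<and> q \<noteq> Suc a" if "q \<in> states M" for q
    using Max_ge[OF fin that] by (auto simp: a_def)
  \<comment> \<open>Leastness ensures that all earlier states are non-final, where the modified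
    transition function agrees with that of \<open>M\<close>.\<close>
  define t where "t = (LEAST t. halts_within M ws t)"
  have ht: "halts_within M ws t"
    using out unfolding t_def outputs_def by (meson LeastI)
  have not: "\<not> halts_within M ws j" if "j < t" for j
    using that unfolding t_def by (rule not_less_Least)
  have same: "run ?N ws j = run M ws j" if "j \<le> t" for j
    using that
  proof (induction j)
    case 0
    then show ?case by (simp add: run_0 initial_def)
  next
    case (Suc j)
    obtain q ts where c: "run M ws j = (q, ts)" by fastforce
    have q: "q \<notin> final M" "q \<in> states M"
      using not[of j] Suc.prems config_ok_run[OF M ws, of j] c
      by (auto simp: halts_within_def config_ok_def)
    then show ?case
      using Suc c fresh[of q] by (simp add: run_Suc succ_machine_def Let_def a_def)
  qed
  obtain q ts where c: "run M ws t = (q, ts)" by fastforce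
  have q: "q \<in> final M" "q \<in> states M" and len: "length ts = tapes M"
    using ht config_ok_run[OF M ws, of t] c by (auto simp: halts_within_def config_ok_def)
  have l: "?l < length ts" using M len by (auto simp: turing_machine_def)
  then have ne: "ts \<noteq> []" by auto
  obtain tp h where th: "ts ! ?l = (tp, h)" by fastforce
  have lastts: "last ts = (tp, h)" using th ne len by (simp add: last_conv_nth)
  have "run ?N ws (Suc t) = (a, ts[?l := (tp, h - 1)])"
    using same[of t] c q fresh[of q] l th len map2_act_stay_update[of ts ?l "(tp h, Left)"]
    by (simp add: run_Suc succ_machine_def Let_def a_def)
  then have "run ?N ws (Suc (Suc t)) = (Suc a, ts[?l := (tp(h - 1 := Bit True), h - 1)])"
    using l map2_act_stay_update[of "ts[?l := (tp, h - 1)]" ?l "(Bit True, Stay)"]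
    by (simp add: run_Suc[of _ _ "Suc t"] succ_machine_def Let_def a_def)
  moreover have "shows_word (tp, h) w"
    using out outputs_iff[OF ht] c lastts by simp
  ultimately have "halts_within ?N ws (Suc (Suc t))"
    "shows_word (last (snd (run ?N ws (Suc (Suc t))))) (True # w)"
    using l len shows_word_Cons[of tp h w True] ne
    by (simp_all add: halts_within_def a_def last_list_update del: shows_word.simps)
  then show ?thesis by (auto simp: outputs_def)
qed

text \<open>Values are written in unary, so one more leading \<open>True\<close> adds one; this is
  repeated \<open>d\<close> times.\<close>

lemma computable_on_add_const:
  assumes "computable_on S f"
  shows "computable_on S (\<lambda>k. f k + d)"
proof (induction d)
  case 0
  then show ?case using assms by simp
next
  case (Suc d)
  then obtain M where M: "turing_machine 1 M"
    "\<And>k. k \<in> params S \<Longrightarrow> outputs M [code S k] (replicate (f k + d) True)"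
    by (auto simp: computable_on_def)
  have "outputs (succ_machine M) [code S k] (replicate (f k + Suc d) True)"
    if "k \<in> params S" for k
    using outputs_succ_machine[OF M(1) _ M(2)[OF that]] by simp
  then show ?case
    using turing_machine_succ_machine[OF M(1)] unfolding computable_on_def by blast
qed

section \<open>The exclusive or of two machines\<close>

text \<open>
  A transition function may be arbitrary on symbols outside its machine's alphabet; in a machine
  with a larger alphabet it has to be replaced by a total variant.
\<close>

definition total_delta :: "tm \<Rightarrow> nat \<Rightarrow> sym list \<Rightarrow> nat \<times> (sym \<times> dir) list" where
  "total_delta M q ss =
     (if q \<in> final M \<or> \<not> set ss \<subseteq> alphabet M then (q, map stay ss) else delta M q ss)"

lemma total_delta_closed:
  assumes "turing_machine r M" "q \<in> states M" "length ss = tapes M" "set ss \<subseteq> B"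
    "alphabet M \<subseteq> B" "total_delta M q ss = (q', acts)"
  shows "q' \<in> states M \<and> length acts = tapes M \<and> fst ` set acts \<subseteq> B"
proof (cases "q \<in> final M \<or> \<not> set ss \<subseteq> alphabet M")
  case True
  then show ?thesis using assms by (auto simp: total_delta_def stay_def)
next
  case False
  then show ?thesis
    using turing_machine_delta[OF assms(1,2) _ assms(3), of q' acts] assms(5,6)
    by (simp add: total_delta_def) blast
qed

text \<open>All scanned symbols lie in the alphabet, so the variant can deviate only in a final
  state. There it idles, which agrees with \<open>step\<close> fixing the configuration.\<close>

lemma step_total_delta:
  assumes "config_ok M (q, ts)"
  shows "step M (q, ts)
    = (case total_delta M q (map read ts) of (q', acts) \<Rightarrow> (q', map2 act acts ts))"
  using config_ok_reads[OF assms] map2_act_stay[of ts] by (simp add: total_delta_def)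

text \<open>\<open>Par\<close> holds one state of each simulated machine. \<open>Check v\<close>
  remembers the prospective answer \<open>v\<close> while the cell after the first machine's answer
  bit is inspected. Countability lets these states be coded as the natural numbers required by
  \<open>tm\<close>.\<close>

datatype xstate = Copy | Rewind | Par nat nat | Check bool | Done

instance xstate :: countable
  by countable_datatype

text \<open>
  The tapes are those of \<open>P\<close>, whose second input is on tape 1, then those of \<open>M\<close>, then
  the output tape.
\<close>

definition xor_delta ::
    "tm \<Rightarrow> tm \<Rightarrow> xstate \<Rightarrow> sym list \<Rightarrow> xstate \<times> (sym \<times> dir) list" where
  "xor_delta P M q ss = (let p = tapes P; m = tapes M; idle = map stay ss in case q of
     Copy \<Rightarrow>
       if ss ! 1 \<in> range Bit then (Copy, idle[1 := (ss ! 1, Right), p := (ss ! 1, Right)])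
       else (Rewind, idle[1 := (ss ! 1, Left), p := (ss ! p, Left)])
   | Rewind \<Rightarrow>
       if ss ! 1 \<in> range Bit then (Rewind, idle[1 := (ss ! 1, Left), p := (ss ! p, Left)])
       else (Par (start P) (start M), idle[1 := (ss ! 1, Right), p := (ss ! p, Right)])
   | Par q1 q2 \<Rightarrow>
       if q1 \<in> final P \<and> q2 \<in> final M then
         if ss ! (p - 1) \<in> range Bit then
           (Check ((ss ! (p - 1) = Bit True) \<noteq> (ss ! (p + m - 1) = Bit True)),
            idle[p - 1 := (ss ! (p - 1), Right)])
         else (Done, idle)
       else
         (case total_delta P q1 (take p ss) of (q1', acts1) \<Rightarrow>
          case total_delta M q2 (take m (drop p ss)) of (q2', acts2) \<Rightarrow>
            (Par q1' q2', acts1 @ acts2 @ [stay (ss ! (p + m))]))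
   | Check v \<Rightarrow>
       if ss ! (p - 1) \<in> range Bit then (Done, idle)
       else (Done, idle[p + m := (Bit v, Stay)])
   | Done \<Rightarrow> (Done, idle))"

definition xor_machine :: "tm \<Rightarrow> tm \<Rightarrow> tm" where
  "xor_machine P M = \<lparr>
     tapes = tapes P + tapes M + 1,
     states = to_nat ` ({Copy, Rewind, Check True, Check False, Done}
       \<union> (\<lambda>(q1, q2). Par q1 q2) ` (states P \<times> states M)),
     alphabet = alphabet P \<union> alphabet M,
     start = to_nat Copy,
     final = {to_nat Done},
     delta = (\<lambda>q ss. map_prod to_nat id (xor_delta P M (from_nat q) ss))\<rparr>"

section \<open>Well-formedness of the combined machine\<close>

lemma set_map_stay_update2:
  assumes "set ss \<subseteq> B" "s \<in> B" "s' \<in> B"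
  shows "fst ` set ((map stay ss)[i := (s, d), j := (s', d')]) \<subseteq> B"
proof -
  have "fst ` set ((map stay ss)[i := (s, d), j := (s', d')])
      \<subseteq> insert s' (fst ` set ((map stay ss)[i := (s, d)]))"
    using image_mono[OF set_update_subset_insert[of "(map stay ss)[i := (s, d)]" j "(s', d')"],
        of fst] by simp
  then show ?thesis using set_map_stay_update[OF assms(1,2), of i d] assms(3) by blast
qed

text \<open>Every symbol written is a scanned one, a bit, or one produced by
  \<open>total_delta\<close>, so the union of the alphabets is never left. \<open>Q\<close> and
  \<open>B\<close> are the states of \<open>xor_machine\<close> before coding and its
  alphabet.\<close>

lemma xor_delta_closed:
  fixes P M
  defines "Q \<equiv> {Copy, Rewind, Check True, Check False, Done}
      \<union> (\<lambda>(q1, q2). Par q1 q2) ` (states P \<times> states M)"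
    and "B \<equiv> alphabet P \<union> alphabet M"
  assumes P: "turing_machine 2 P" and M: "turing_machine 1 M"
    and q: "q \<in> Q" and len: "length ss = tapes P + tapes M + 1" and ss: "set ss \<subseteq> B"
  shows "fst (xor_delta P M q ss) \<in> Q \<and>
    length (snd (xor_delta P M q ss)) = tapes P + tapes M + 1 \<and>
    fst ` set (snd (xor_delta P M q ss)) \<subseteq> B"
proof -
  have pm: "2 \<le> tapes P" "1 \<le> tapes M" using P M by (auto simp: turing_machine_def)
  have nth: "ss ! i \<in> B" if "i \<le> tapes P + tapes M" for i
    using that len ss by (metis Suc_eq_plus1 less_Suc_eq_le nth_mem subsetD)
  have nths: "ss ! 1 \<in> B" "ss ! tapes P \<in> B" "ss ! (tapes P - 1) \<in> B"
    by (rule nth; use pm in simp)+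
  have bits: "Bit v \<in> B" for v using P by (auto simp: turing_machine_def B_def)
  have idle: "fst ` set (map stay ss) \<subseteq> B" using ss by (auto simp: stay_def)
  note upd = set_map_stay_update[OF ss] set_map_stay_update2[OF ss]
  have startQ: "Par (start P) (start M) \<in> Q"
    using P M by (auto simp: Q_def turing_machine_def)
  have Qs: "Copy \<in> Q" "Rewind \<in> Q" "Check v \<in> Q" "Done \<in> Q" for v
    by (cases v; simp add: Q_def)+
  show ?thesis
  proof (cases q)
    case Copy
    then show ?thesis
      using len Qs upd(2) nths by (simp add: xor_delta_def Let_def del: set_map One_nat_def)
  next
    case Rewind
    then show ?thesis
      using len Qs startQ upd(2) nths
      by (simp add: xor_delta_def Let_def del: set_map One_nat_def)
  next
    case (Check v)
    then show ?thesis
      using len Qs idle upd(1)[OF bits] by (simp add: xor_delta_def Let_def del: set_map)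
  next
    case Done
    then show ?thesis
      using len Qs idle by (simp add: xor_delta_def Let_def del: set_map)
  next
    case (Par q1 q2)
    show ?thesis
    proof (cases "q1 \<in> final P \<and> q2 \<in> final M")
      case True
      then show ?thesis
        using Par len Qs idle upd(1) nths
        by (simp add: xor_delta_def Let_def del: set_map One_nat_def)
    next
      case False
      have q12: "q1 \<in> states P" "q2 \<in> states M" using Par q by (auto simp: Q_def)
      obtain q1' a1 where 1: "total_delta P q1 (take (tapes P) ss) = (q1', a1)" by fastforce
      obtain q2' a2 where 2: "total_delta M q2 (take (tapes M) (drop (tapes P) ss)) = (q2', a2)"
        by fastforce
      have "set (take (tapes P) ss) \<subseteq> B" "set (take (tapes M) (drop (tapes P) ss)) \<subseteq> B"
        using ss by (meson set_take_subset set_drop_subset subset_trans)+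
      then have "q1' \<in> states P \<and> length a1 = tapes P \<and> fst ` set a1 \<subseteq> B"
        "q2' \<in> states M \<and> length a2 = tapes M \<and> fst ` set a2 \<subseteq> B"
        using total_delta_closed[OF P q12(1) _ _ _ 1, of B]
          total_delta_closed[OF M q12(2) _ _ _ 2, of B] len by (auto simp: B_def)
      moreover have "fst (stay (ss ! (tapes P + tapes M))) \<in> B"
        using nth by (simp add: stay_def)
      moreover have "xor_delta P M q ss
          = (Par q1' q2', a1 @ a2 @ [stay (ss ! (tapes P + tapes M))])"
        using Par False 1 2 by (auto simp: xor_delta_def Let_def)
      moreover have "Par q1' q2' \<in> Q" using calculation by (auto simp: Q_def)
      ultimately show ?thesis by (simp add: image_Un)
    qed
  qed
qed

lemma turing_machine_xor_machine:
  assumes P: "turing_machine 2 P" and M: "turing_machine 1 M"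
  shows "turing_machine 2 (xor_machine P M)"
proof (rule turing_machineI)
  fix q ss q' acts
  assume q: "q \<in> states (xor_machine P M)"
    and ss: "length ss = tapes (xor_machine P M)" "set ss \<subseteq> alphabet (xor_machine P M)"
    and d: "delta (xor_machine P M) q ss = (q', acts)"
  obtain q0 where q0: "q0 \<in> {Copy, Rewind, Check True, Check False, Done}
       \<union> (\<lambda>(q1, q2). Par q1 q2) ` (states P \<times> states M)" "q = to_nat q0"
    using q unfolding xor_machine_def tm.simps by (rule imageE)
  obtain r where r: "xor_delta P M q0 ss = (r, acts)" "q' = to_nat r"
    using d q0(2) by (auto simp: xor_machine_def map_prod_def split: prod.splits)
  show "q' \<in> states (xor_machine P M) \<and> length acts = tapes (xor_machine P M) \<and>
      fst ` set acts \<subseteq> alphabet (xor_machine P M)"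
    using xor_delta_closed[OF P M q0(1), of ss] ss r unfolding xor_machine_def tm.simps
    by (metis fst_conv imageI snd_conv)
qed (use P M in \<open>auto simp: turing_machine_def xor_machine_def\<close>)

lemma step_xor_machine:
  assumes "q \<noteq> Done"
  shows "step (xor_machine P M) (to_nat q, ts)
    = (case xor_delta P M q (map read ts) of (q', acts) \<Rightarrow> (to_nat q', map2 act acts ts))"
  using assms by (simp add: xor_machine_def split: prod.splits)

section \<open>Tapes holding a word\<close>

lemma word_tape_nth:
  "fst (word_tape w) (int i) = (if i < length w then Bit (w ! i) else Blank)"
  by (simp add: word_tape_def)

lemma word_tape_neg: "i < 0 \<Longrightarrow> fst (word_tape w) i = Blank"
  by (simp add: word_tape_def)

text \<open>The induction step of the copying phase: writing the next letter turns the tape of one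
  prefix into the tape of the next.\<close>

lemma word_tape_take_Suc:
  assumes "j < length w"
  shows "(fst (word_tape (take j w)))(int j := Bit (w ! j)) = fst (word_tape (take (Suc j) w))"
proof
  fix i :: int
  show "((fst (word_tape (take j w)))(int j := Bit (w ! j))) i
      = fst (word_tape (take (Suc j) w)) i"
    using assms by (cases "i < 0"; cases "i = int j") (auto simp: word_tape_def nat_less_iff)
qed

section \<open>The run of the combined machine on a fixed pair of inputs\<close>

locale xor_run =
  fixes P M :: tm and u x :: "bool list"
  assumes P: "turing_machine 2 P" and M: "turing_machine 1 M"
begin

abbreviation "N \<equiv> xor_machine P M"
abbreviation "p \<equiv> tapes P"
abbreviation "m \<equiv> tapes M"

lemma p_ge: "2 \<le> p" and m_ge: "1 \<le> m"
  using P M by (auto simp: turing_machine_def)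

text \<open>While copying and rewinding, only tape 1 (the second input of \<open>P\<close>) and tape
  \<open>p\<close> (the input of \<open>M\<close>) change, so configurations are described by these
  two tapes alone.\<close>

definition tapes_with :: "tape \<Rightarrow> tape \<Rightarrow> tape list" where
  "tapes_with t1 t2 = (snd (initial N [u, x]))[1 := t1, p := t2]"

lemma length_initial_tapes: "length (snd (initial N [u, x])) = p + m + 1"
  using p_ge by (simp add: initial_def xor_machine_def)

lemma tapes_with_nth:
  "tapes_with t1 t2 ! 1 = t1" "tapes_with t1 t2 ! p = t2"
  "tapes_with t1 t2 ! Suc 0 = t1"
  using p_ge length_initial_tapes by (auto simp: tapes_with_def nth_list_update)

lemma length_tapes_with: "length (tapes_with t1 t2) = p + m + 1"
  using length_initial_tapes by (simp add: tapes_with_def)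

lemma tapes_with_update:
  "(tapes_with t1 t2)[1 := t1', p := t2'] = tapes_with t1' t2'"
  using p_ge length_initial_tapes
  by (intro nth_equalityI) (auto simp: tapes_with_def nth_list_update)

lemma initial_eq: "initial N [u, x] = (to_nat Copy, tapes_with (word_tape x) (word_tape []))"
proof -
  have "snd (initial N [u, x]) ! 1 = word_tape x" "snd (initial N [u, x]) ! p = word_tape []"
    using p_ge by (auto simp: initial_def xor_machine_def nth_append)
  then have "tapes_with (word_tape x) (word_tape []) = snd (initial N [u, x])"
    unfolding tapes_with_def by (metis list_update_id)
  then show ?thesis by (simp add: initial_def xor_machine_def)
qed

lemma step_tapes_with:
  assumes "q \<noteq> Done"
    "xor_delta P M q (map read (tapes_with t1 t2))
      = (q', (map stay (map read (tapes_with t1 t2)))[1 := a, p := b])"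
  shows "step N (to_nat q, tapes_with t1 t2) = (to_nat q', tapes_with (act a t1) (act b t2))"
proof -
  have "map2 act ((map stay (map read (tapes_with t1 t2)))[1 := a, p := b]) (tapes_with t1 t2)
      = tapes_with (act a t1) (act b t2)"
    using map2_act_stay_update2[of 1 p "tapes_with t1 t2" a b] p_ge
    by (simp add: tapes_with_nth tapes_with_update del: One_nat_def map_map)
  then show ?thesis using step_xor_machine[OF assms(1)] assms(2) by simp
qed

lemma reads_tapes_with:
  "map read (tapes_with t1 t2) ! 1 = read t1" "map read (tapes_with t1 t2) ! p = read t2"
  using p_ge by (simp_all add: length_tapes_with tapes_with_nth del: One_nat_def)

text \<open>Invariant: both heads stand at \<open>j\<close>, and tape \<open>p\<close> carries the
  prefix copied so far.\<close>

lemma copy_phase: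
  assumes "j \<le> length x"
  shows "run N [u, x] j
    = (to_nat Copy, tapes_with (fst (word_tape x), int j) (fst (word_tape (take j x)), int j))"
  using assms
proof (induction j)
  case 0
  then show ?case by (simp add: run_0 initial_eq word_tape_def)
next
  case (Suc j)
  let ?t1 = "(fst (word_tape x), int j)" and ?t2 = "(fst (word_tape (take j x)), int j)"
  have r: "read ?t1 = Bit (x ! j)" using Suc.prems by (simp add: word_tape_nth)
  have "step N (to_nat Copy, tapes_with ?t1 ?t2)
      = (to_nat Copy, tapes_with (act (Bit (x ! j), Right) ?t1) (act (Bit (x ! j), Right) ?t2))"
    by (rule step_tapes_with)
      (use r in \<open>simp_all add: xor_delta_def Let_def reads_tapes_with
         del: One_nat_def map_map read.simps\<close>)
  moreover have "act (Bit (x ! j), Right) ?t1 = (fst (word_tape x), int (Suc j))"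
    using r by (auto simp: fun_upd_idem)
  moreover have "act (Bit (x ! j), Right) ?t2 = (fst (word_tape (take (Suc j) x)), int (Suc j))"
    using word_tape_take_Suc[of j x] Suc.prems by simp
  ultimately show ?case using Suc by (simp add: run_Suc del: step.simps act.simps of_nat_Suc)
qed

lemma act_read: "act (read (t, h), d) (t, h) = (t, h + offset d)"
  by simp

text \<open>The step that discovers the blank after \<open>x\<close> already moves both heads left;
  hence the extra 1 in the time and the start at the last letter. At \<open>j = length x\<close> the
  heads are at -1, on the blank before the word.\<close>

lemma rewind_phase:
  assumes "j \<le> length x"
  shows "run N [u, x] (length x + 1 + j)
    = (to_nat Rewind, tapes_with (fst (word_tape x), int (length x) - 1 - int j)
        (fst (word_tape x), int (length x) - 1 - int j))"
  using assms
proof (induction j)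
  case 0
  let ?t = "(fst (word_tape x), int (length x))"
  have "read ?t = Blank" by (simp add: word_tape_nth)
  then have "step N (to_nat Copy, tapes_with ?t ?t)
      = (to_nat Rewind, tapes_with (act (read ?t, Left) ?t) (act (read ?t, Left) ?t))"
    by (intro step_tapes_with)
      (auto simp add: xor_delta_def Let_def reads_tapes_with
         simp del: One_nat_def map_map read.simps)
  then show ?case
    using copy_phase[of "length x"] by (simp add: run_Suc act_read del: act.simps read.simps)
next
  case (Suc j)
  let ?h = "int (length x) - 1 - int j"
  let ?t = "(fst (word_tape x), ?h)"
  have h: "?h = int (length x - 1 - j)" using Suc.prems by linarith
  have "fst (word_tape x) (int (length x - 1 - j)) \<in> range Bit"
    using Suc.prems by (simp only: word_tape_nth) simp
  then have "read ?t \<in> range Bit" by (simp only: h read.simps)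
  then have "step N (to_nat Rewind, tapes_with ?t ?t)
      = (to_nat Rewind, tapes_with (act (read ?t, Left) ?t) (act (read ?t, Left) ?t))"
    by (intro step_tapes_with)
      (auto simp add: xor_delta_def Let_def reads_tapes_with
         simp del: One_nat_def map_map read.simps)
  moreover have "act (read ?t, Left) ?t
      = (fst (word_tape x), int (length x) - 1 - int (Suc j))"
    by (simp add: act_read del: act.simps read.simps)
  ultimately show ?case using Suc by (simp add: run_Suc del: act.simps read.simps)
qed

text \<open>With n the length of \<open>x\<close>: n steps copy, one turns around, n rewind, and one
  moves from -1 to 0. The heads are then back at the origin, so the tapes are exactly those of two
  fresh initial configurations and a blank output tape.\<close>

lemma par_start:
  "run N [u, x] (2 * length x + 2)
    = (to_nat (Par (start P) (start M)),
       snd (initial P [u, x]) @ snd (initial M [x]) @ [word_tape []])"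
proof -
  let ?t = "(fst (word_tape x), -1)"
  have "read ?t = Blank" by (simp add: word_tape_neg)
  then have "step N (to_nat Rewind, tapes_with ?t ?t)
      = (to_nat (Par (start P) (start M)),
         tapes_with (act (read ?t, Right) ?t) (act (read ?t, Right) ?t))"
    by (intro step_tapes_with)
      (auto simp add: xor_delta_def Let_def reads_tapes_with
         simp del: One_nat_def map_map read.simps)
  moreover have "act (read ?t, Right) ?t = word_tape x"
    by (simp add: act_read del: act.simps read.simps) (simp add: word_tape_def)
  moreover have "2 * length x + 2 = Suc (length x + 1 + length x)" by simp
  ultimately have "run N [u, x] (2 * length x + 2)
      = (to_nat (Par (start P) (start M)), tapes_with (word_tape x) (word_tape x))"
    using rewind_phase[of "length x"] by (simp only: run_Suc) simp
  moreover have "tapes_with (word_tape x) (word_tape x)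
      = snd (initial P [u, x]) @ snd (initial M [x]) @ [word_tape []]"
  proof -
    obtain p' where p': "p = Suc (Suc p')" using p_ge by (metis add_2_eq_Suc le_Suc_ex)
    obtain m' where m': "m = Suc m'" using m_ge by (metis Suc_le_D One_nat_def)
    \<comment> \<open>The initially blank tapes are the remaining tapes of \<open>P\<close>, tape
      \<open>p\<close>, which receives the copy of \<open>x\<close>, the remaining tapes of
      \<open>M\<close>, and the output tape.\<close>
    have "replicate (p' + m + 1) (word_tape []) =
        replicate p' (word_tape []) @ word_tape [] # replicate m' (word_tape []) @ [word_tape []]"
      using replicate_add[of p' "Suc (Suc m')" "word_tape []"] m'
      by (simp add: replicate_append_same)
    then show ?thesis
      by (simp add: tapes_with_def initial_def xor_machine_def p' m' list_update_append)
  qed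
  ultimately show ?thesis by simp
qed

text \<open>If one machine stops first, \<open>total_delta\<close> lets it idle, matching its frozen
  run. The hypothesis keeps the combined machine in the simulating branch of \<open>Par\<close> for
  all \<open>j\<close> steps.\<close>

lemma par_phase:
  assumes "\<And>i. i < j \<Longrightarrow> \<not> (halts_within P [u, x] i \<and> halts_within M [x] i)"
  shows "run N [u, x] (2 * length x + 2 + j)
    = (to_nat (Par (fst (run P [u, x] j)) (fst (run M [x] j))),
       snd (run P [u, x] j) @ snd (run M [x] j) @ [word_tape []])"
  using assms
proof (induction j)
  case 0
  then show ?case using par_start by (simp add: run_0) (simp add: initial_def)
next
  case (Suc j)
  obtain q1 ts1 where c1: "run P [u, x] j = (q1, ts1)" by fastforce
  obtain q2 ts2 where c2: "run M [x] j = (q2, ts2)" by fastforce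
  have ok1: "config_ok P (q1, ts1)" and ok2: "config_ok M (q2, ts2)"
    using config_ok_run[OF P, of "[u, x]" j] config_ok_run[OF M, of "[x]" j] c1 c2 by auto
  then have len: "length ts1 = p" "length ts2 = m" and st: "q1 \<in> states P" "q2 \<in> states M"
    by (auto simp: config_ok_def)
  obtain q1' a1 where d1: "total_delta P q1 (map read ts1) = (q1', a1)" by fastforce
  obtain q2' a2 where d2: "total_delta M q2 (map read ts2) = (q2', a2)" by fastforce
  \<comment> \<open>Only the lengths matter here, so the symbols are bounded trivially by
    \<open>UNIV\<close>.\<close>
  have la: "length a1 = p" "length a2 = m"
    using total_delta_closed[OF P st(1) _ _ _ d1, of UNIV]
      total_delta_closed[OF M st(2) _ _ _ d2, of UNIV] len by auto
  have "\<not> (q1 \<in> final P \<and> q2 \<in> final M)"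
    using Suc.prems[of j] c1 c2 by (simp add: halts_within_def)
  then have "step N (to_nat (Par q1 q2), ts1 @ ts2 @ [word_tape []])
    = (to_nat (Par q1' q2'), map2 act a1 ts1 @ map2 act a2 ts2 @ [word_tape []])"
    using len la d1 d2
    by (subst step_xor_machine)
      (auto simp add: xor_delta_def Let_def nth_append stay_def word_tape_def)
  moreover have "run N [u, x] (2 * length x + 2 + j)
      = (to_nat (Par q1 q2), ts1 @ ts2 @ [word_tape []])"
    using Suc c1 c2 by simp
  moreover have "run P [u, x] (Suc j) = (q1', map2 act a1 ts1)"
    "run M [x] (Suc j) = (q2', map2 act a2 ts2)"
    using c1 c2 step_total_delta[OF ok1] step_total_delta[OF ok2] d1 d2
    by (simp_all add: run_Suc)
  ultimately show ?case by (simp add: run_Suc)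
qed

text \<open>If \<open>P\<close> answers \<open>a\<close>, the result is
  \<open>v = (a \<noteq> b)\<close>, equivalently \<open>a = (v \<noteq> b)\<close>. Being an
  equivalence for each \<open>v\<close>, this transfers the domain as well as correctness. The time
  is \<open>2 * length x + 2\<close> for preparation, at most \<open>t\<close> for the simulation
  and 2 for the answer.\<close>

lemma xor_machine_result:
  assumes halts: "halts_within P [u, x] t" "halts_within M [x] t" and out: "outputs M [x] [b]"
  shows "halts_within N [u, x] (2 * length x + 4 + t)"
    and "outputs N [u, x] [v] \<longleftrightarrow> outputs P [u, x] [v \<noteq> b]"
proof -
  \<comment> \<open>The first moment at which both machines have stopped is where
    \<open>par_phase\<close> ends and the answer is evaluated.\<close>
  define s where "s = (LEAST s. halts_within P [u, x] s \<and> halts_within M [x] s)"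
  have s: "halts_within P [u, x] s" "halts_within M [x] s"
    using LeastI[of "\<lambda>s. halts_within P [u, x] s \<and> halts_within M [x] s" t] halts
    unfolding s_def by blast+
  have "s \<le> t" unfolding s_def using halts by (intro Least_le) blast
  have ns: "\<not> (halts_within P [u, x] i \<and> halts_within M [x] i)" if "i < s" for i
    using that unfolding s_def by (rule not_less_Least)
  let ?T = "2 * length x + 2 + s"
  obtain q1 ts1 where c1: "run P [u, x] s = (q1, ts1)" by fastforce
  obtain q2 ts2 where c2: "run M [x] s = (q2, ts2)" by fastforce
  have len: "length ts1 = p" "length ts2 = m"
    using config_ok_run[OF P, of "[u, x]" s] config_ok_run[OF M, of "[x]" s] c1 c2
    by (auto simp: config_ok_def)
  have fin: "q1 \<in> final P" "q2 \<in> final M" using s c1 c2 by (auto simp: halts_within_def)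
  let ?ts = "ts1 @ ts2 @ [word_tape []]"
  have run0: "run N [u, x] ?T = (to_nat (Par q1 q2), ?ts)"
    using par_phase[OF ns] c1 c2 by simp
  obtain tp h where th: "last ts1 = (tp, h)" by fastforce
  have ne: "ts1 \<noteq> []" "ts2 \<noteq> []" using len p_ge m_ge by auto
  have nth1: "?ts ! (p - 1) = (tp, h)"
    using th ne len p_ge by (simp add: nth_append last_conv_nth)
  have nth2: "?ts ! (p + m - 1) = last ts2"
  proof -
    have "?ts ! (length ts1 + (m - 1)) = (ts2 @ [word_tape []]) ! (m - 1)"
      by (rule nth_append_length_plus)
    moreover have "length ts1 + (m - 1) = p + m - 1" using len m_ge by simp
    ultimately show ?thesis using ne len m_ge by (simp add: nth_append last_conv_nth)
  qed
  have lenN: "length ?ts = p + m + 1" using len by simp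
  \<comment> \<open>The output of \<open>M\<close> is known to be a single letter, so its scanned
    bit is the whole answer; only the output of \<open>P\<close> has to be tested for its
    length.\<close>
  have readM: "read (last ts2) = Bit b"
    using out outputs_iff[OF s(2)] c2 by (cases "last ts2") (simp add: shows_word_singleton)
  have outP: "outputs P [u, x] [w] \<longleftrightarrow> tp h = Bit w \<and> tp (h + 1) \<notin> range Bit" for w
    using outputs_iff[OF s(1)] c1 th by simp
  have reads: "map read ?ts ! (p - 1) = tp h" "map read ?ts ! (p + m - 1) = Bit b"
    using nth_map[of "p - 1" ?ts read] nth_map[of "p + m - 1" ?ts read] lenN nth1 nth2 readM
      p_ge by (simp_all del: map_append)
  have done_step: "step N (to_nat Done, ts) = (to_nat Done, ts)" for ts
    by (simp add: xor_machine_def)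
  \<comment> \<open>Two steps suffice in every case; if \<open>P\<close> has empty output,
    \<open>Done\<close> is reached after one and the second is idle.\<close>
  have *: "\<exists>ts. run N [u, x] (?T + 2) = (to_nat Done, ts) \<and>
    (shows_word (last ts) [v] \<longleftrightarrow> outputs P [u, x] [v \<noteq> b])"
  proof (cases "tp h \<in> range Bit")
    case False
    have "step N (to_nat (Par q1 q2), ?ts) = (to_nat Done, ?ts)"
      using False reads fin map2_act_stay[of ?ts]
      by (simp add: step_xor_machine xor_delta_def Let_def del: map_map map_append step.simps)
    then have "run N [u, x] (?T + 2) = (to_nat Done, ?ts)"
      using run0 done_step by (simp add: run_Suc del: step.simps)
    moreover have "\<not> shows_word (last ?ts) [v]" by (simp add: word_tape_def)
    ultimately show ?thesis using False outP by auto
  next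
    case True
    then obtain a where a: "tp h = Bit a" by auto
    let ?ts' = "?ts[p - 1 := (tp, h + 1)]"
    have "step N (to_nat (Par q1 q2), ?ts) = (to_nat (Check (a \<noteq> b)), ?ts')"
      using a reads fin map2_act_stay_update[of ?ts "p - 1" "(tp h, Right)"] nth1
      by (simp add: fun_upd_idem step_xor_machine xor_delta_def Let_def
          del: map_map map_append step.simps)
    then have run1: "run N [u, x] (Suc ?T) = (to_nat (Check (a \<noteq> b)), ?ts')"
      using run0 by (simp only: run_Suc)
    have len': "length ?ts' = p + m + 1" using lenN by simp
    have ne': "?ts' \<noteq> []" using ne by simp
    have last': "?ts' ! (p + m) = word_tape []"
      using len p_ge by (simp add: nth_append)
    have read': "map read ?ts' ! (p - 1) = tp (h + 1)"
      using nth_map[of "p - 1" ?ts' read] lenN p_ge by (simp del: map_append)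
    show ?thesis
    proof (cases "tp (h + 1) \<in> range Bit")
      case True
      \<comment> \<open>The output of \<open>P\<close> has at least two bits, hence is no answer,
        and the output tape is left blank.\<close>
      have "step N (to_nat (Check (a \<noteq> b)), ?ts') = (to_nat Done, ?ts')"
        using True read' map2_act_stay[of ?ts']
        by (simp add: step_xor_machine xor_delta_def Let_def
            del: map_map map_append step.simps)
      then have "run N [u, x] (?T + 2) = (to_nat Done, ?ts')"
        using run1 by (simp add: run_Suc[of _ _ "Suc _"] del: step.simps)
      moreover have "last ?ts' = word_tape []"
        using last_conv_nth[OF ne'] last' by (simp only: len' add_diff_cancel_right')
      moreover have "\<not> shows_word (word_tape []) [v]" by (simp add: word_tape_def)
      moreover have "\<not> outputs P [u, x] [v \<noteq> b]" using True outP by blast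
      ultimately show ?thesis by (intro exI[of _ ?ts'] conjI) (simp_all only: simp_thms)
    next
      case False
      \<comment> \<open>Here \<open>P\<close> has answered exactly \<open>[a]\<close>, so the
        exclusive or is written to the output tape.\<close>
      let ?ts'' = "?ts'[p + m := act (Bit (a \<noteq> b), Stay) (word_tape [])]"
      have "step N (to_nat (Check (a \<noteq> b)), ?ts') = (to_nat Done, ?ts'')"
        using False read' map2_act_stay_update[of ?ts' "p + m" "(Bit (a \<noteq> b), Stay)"] last'
        by (simp add: step_xor_machine xor_delta_def Let_def
            del: map_map map_append step.simps)
      then have "run N [u, x] (?T + 2) = (to_nat Done, ?ts'')"
        using run1 by (simp add: run_Suc[of _ _ "Suc _"] del: step.simps)
      moreover have "last ?ts'' = act (Bit (a \<noteq> b), Stay) (word_tape [])"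
        by (simp only: last_list_update[OF ne'] len' add_diff_cancel_right' if_True simp_thms)
      moreover have "shows_word (act (Bit (a \<noteq> b), Stay) (word_tape [])) [v] \<longleftrightarrow> (a \<noteq> b) = v"
        by (auto simp: word_tape_def)
      moreover have "outputs P [u, x] [v \<noteq> b] \<longleftrightarrow> (a \<noteq> b) = v"
        using outP False a by auto
      ultimately show ?thesis by (intro exI[of _ ?ts''] conjI) (simp_all only:)
    qed
  qed
  then have hN: "halts_within N [u, x] (?T + 2)"
    by (auto simp: halts_within_def xor_machine_def)
  then show "halts_within N [u, x] (2 * length x + 4 + t)"
    by (rule halts_within_mono) (use \<open>s \<le> t\<close> in simp)
  show "outputs N [u, x] [v] \<longleftrightarrow> outputs P [u, x] [v \<noteq> b]"
    using * by (auto simp only: outputs_iff[OF hN] snd_conv)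
qed

end

section \<open>Invariance of fixed-parameter tractability\<close>

text \<open>The asymptotic bound holds from some \<open>n0\<close> on. The finitely many earlier
  values are covered by adding their sum to the constant, since \<open>n ^ c\<close> is at least 1
  for positive \<open>n\<close>.\<close>

lemma bigo_power_bound:
  fixes T :: "nat \<Rightarrow> nat"
  assumes "(\<lambda>n. real (T n)) \<in> O(\<lambda>n. real n ^ c)"
  obtains C where "\<And>n. 1 \<le> n \<Longrightarrow> T n \<le> C * n ^ c"
proof -
  obtain K where "eventually (\<lambda>n. norm (real (T n)) \<le> K * norm (real n ^ c)) sequentially"
    using landau_o.bigE[OF assms] by blast
  then obtain n0 where n0: "\<And>n. n0 \<le> n \<Longrightarrow> real (T n) \<le> K * real n ^ c"
    by (auto simp: eventually_sequentially)
  define C where "C = nat \<lceil>K\<rceil> + (\<Sum>i<n0. T i)"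
  have "T n \<le> C * n ^ c" if "1 \<le> n" for n
  proof (cases "n < n0")
    case True
    have "T n \<le> (\<Sum>i<n0. T i)" using True by (intro member_le_sum) auto
    also have "\<dots> \<le> C * 1" by (simp add: C_def)
    also have "\<dots> \<le> C * n ^ c" using that by (intro mult_le_mono2) simp
    finally show ?thesis .
  next
    case False
    then have "real (T n) \<le> K * real n ^ c" using n0 by simp
    also have "\<dots> \<le> real C * real n ^ c"
    proof (rule mult_right_mono)
      have "K \<le> real (nat \<lceil>K\<rceil>)" by (rule real_nat_ceiling_ge)
      also have "\<dots> \<le> real C" by (simp only: C_def of_nat_le_iff)
      finally show "K \<le> real C" .
    qed simp
    finally have "real (T n) \<le> real (C * n ^ c)" by simp
    then show ?thesis by (simp only: of_nat_le_iff)
  qed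
  then show ?thesis using that by blast
qed

text \<open>A single machine \<open>xor_machine P M\<close> serves all parameters: the machine for
  \<open>X\<close> does not see \<open>k\<close>, so its cost enters the bound only through a
  constant.\<close>

lemma in_FPT_symdiff:
  fixes S :: "'k pspace"
  assumes X: "X \<in> class_P" and fpt: "in_FPT S A \<eta>"
  shows "in_FPT S ((A - X) \<union> (X - A)) \<eta>"
proof -
  obtain M d T where M: "turing_machine 1 M" and T: "runs_in_time M [] T"
    "(\<lambda>n. real (T n)) \<in> O(\<lambda>n. real n ^ d)"
    and outM: "\<And>x. x \<in> bin_words \<Longrightarrow> outputs M [x] [x \<in> X]"
    using X unfolding class_P_def poly_bounded_def by blast
  obtain C where C: "\<And>n. 1 \<le> n \<Longrightarrow> T n \<le> C * n ^ d"
    using bigo_power_bound[OF T(2)] by blast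
  obtain c P f where P: "turing_machine 2 P" and f: "computable_on S f"
    and app: "\<And>k. k \<in> params S \<Longrightarrow> approximation c P [code S k] A"
    and dom: "\<And>k. k \<in> params S \<Longrightarrow> proc_dom P [code S k] = slice \<eta> k"
    and time: "\<And>k. k \<in> params S \<Longrightarrow> runs_in_time P [code S k] (\<lambda>n. f k * n ^ c)"
    using fpt unfolding in_FPT_def by blast
  let ?N = "xor_machine P M"
  \<comment> \<open>The exponent dominates \<open>c\<close>, \<open>d\<close> and the 1 needed for
    the linear cost of copying.\<close>
  define e where "e = c + d + 1"
  \<comment> \<open>\<open>C\<close> pays for deciding \<open>X\<close>, and 6 for the overhead:
    \<open>2 * n + 4\<close> is at most \<open>6 * n\<close> for positive \<open>n\<close>.\<close>
  define g where "g = (\<lambda>k. f k + (C + 6))"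
  have result: "halts_within ?N [code S k, x] (g k * length x ^ e) \<and>
      (\<forall>v. outputs ?N [code S k, x] [v] \<longleftrightarrow> outputs P [code S k, x] [v \<noteq> (x \<in> X)])"
    if k: "k \<in> params S" and x: "x \<in> bin_words" for k x
  proof -
    interpret xor_run P M "code S k" x by unfold_locales (fact P M)+
    let ?n = "length x"
    have n: "1 \<le> ?n" using x by (cases x) (auto simp: bin_words_def)
    define t where "t = f k * ?n ^ c + C * ?n ^ d"
    have hP: "halts_within P [code S k, x] t"
      by (rule halts_within_mono[of _ _ "f k * ?n ^ c"])
        (use time[OF k] x in \<open>auto simp: runs_in_time_def t_def\<close>)
    have hM: "halts_within M [x] t"
      by (rule halts_within_mono[of _ _ "T ?n"])
        (use T(1) x C[OF n] in \<open>auto simp: runs_in_time_def t_def\<close>)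
    have pow: "?n ^ i \<le> ?n ^ e" if "i \<le> e" for i
      using n that by (intro power_increasing) auto
    have "t \<le> f k * ?n ^ e + C * ?n ^ e"
      unfolding t_def by (intro add_mono mult_le_mono2 pow) (auto simp: e_def)
    moreover have "2 * ?n + 4 \<le> 6 * ?n ^ e"
      using n pow[of 1] by (simp add: e_def del: power_Suc)
    ultimately have "2 * ?n + 4 + t \<le> g k * ?n ^ e"
      by (simp add: g_def algebra_simps)
    then show ?thesis
      using xor_machine_result[OF hP hM outM[OF x]] halts_within_mono by blast
  qed
  have time': "runs_in_time ?N [code S k] (\<lambda>n. g k * n ^ e)" if "k \<in> params S" for k
    using result[OF that] by (simp add: runs_in_time_def)
  \<comment> \<open>For fixed \<open>k\<close> the factor \<open>g k\<close> is a constant, absorbed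
    by the O-notation.\<close>
  have "poly_bounded e ?N [code S k]" if "k \<in> params S" for k
    unfolding poly_bounded_def
    by (rule exI, rule conjI, rule time'[OF that]) simp
  moreover have "partial_decision_procedure ?N [code S k] ((A - X) \<union> (X - A))"
    if k: "k \<in> params S" for k
  proof -
    have "partial_decision_procedure P [code S k] A"
      using app[OF k] by (simp add: approximation_def)
    then have answer: "(x \<in> A) = w"
      if "x \<in> bin_words" "outputs P [code S k, x] [w]" for x w
      using that unfolding partial_decision_procedure_def by (cases w) auto
    have "(x \<in> (A - X) \<union> (X - A)) = v"
      if "x \<in> bin_words" "outputs ?N [code S k, x] [v]" for x v
      using answer[of x "v \<noteq> (x \<in> X)"] result[OF k that(1)] that by auto
    then show ?thesis unfolding partial_decision_procedure_def by auto
  qed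
  moreover have "proc_dom ?N [code S k] = slice \<eta> k" if k: "k \<in> params S" for k
  proof -
    have "proc_dom ?N [code S k] = proc_dom P [code S k]"
    proof -
      \<comment> \<open>For fixed \<open>x\<close>, exclusive or with membership in \<open>X\<close>
        permutes the two answers, so whether any answer is given is unaffected.\<close>
      have "outputs ?N [code S k, x] [True] \<or> outputs ?N [code S k, x] [False] \<longleftrightarrow>
          outputs P [code S k, x] [True] \<or> outputs P [code S k, x] [False]"
        if "x \<in> bin_words" for x
        using result[OF k that] by (cases "x \<in> X") auto
      then show ?thesis unfolding proc_dom_def by auto
    qed
    then show ?thesis using dom[OF k] by simp
  qed
  moreover have "computable_on S g"
    unfolding g_def by (rule computable_on_add_const[OF f])
  ultimately show ?thesis
    using turing_machine_xor_machine[OF P M] time' unfolding in_FPT_def approximation_def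
    by blast
qed

theorem theorem18:
  fixes S :: "'k pspace" and A X :: "bool list set"
  assumes "parameter_space S"
    and "X \<in> class_P"
    and "A \<subseteq> bin_words"
  shows "FPT_parameterizations S A = FPT_parameterizations S ((A - X) \<union> (X - A))
    \<and> (\<forall>\<eta>. parameterization S \<eta> \<longrightarrow>
          (in_FPT S A \<eta> \<longleftrightarrow> in_FPT S ((A - X) \<union> (X - A)) \<eta>))"
proof -
  let ?D = "(A - X) \<union> (X - A)"
  have "(?D - X) \<union> (X - ?D) = A" by blast
  then have "in_FPT S A \<eta> \<longleftrightarrow> in_FPT S ?D \<eta>" for \<eta>
    using in_FPT_symdiff[OF assms(2), of S A \<eta>] in_FPT_symdiff[OF assms(2), of S ?D \<eta>]
    by auto
  then show ?thesis by (simp add: FPT_parameterizations_def)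
qed

end
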